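(* Let $n$ be a nonnegative integer. There is a delicate cubefree binary word of length $n$ if and only if $n \in \{20, 21, 22, 29, 33, 34, 35\} \cup \{m \mid m \geq 38\}$.
   Context: Words are finite strings over the binary alphabet $\{0,1\}$. A factor of a word is a contiguous subword. A cube is a word of the form $XXX$ with $X$ a nonempty word; a word is cubefree if none of its factors is a cube. A delicate cubefree word is a nonempty cubefree word such that changing any single one of its letters to the other letter of the alphabet yields a word containing a cube as a factor. *)

theory Defs
  imports "HOL-Library.Sublist"
begin

text \<open>The binary alphabet is represented by \<^typ>\<open>bool\<close> (\<^const>\<open>False\<close> for 0, \<^const>\<open>True\<close> for 1),
  so the other letter of the alphabet is the negation. The factors of a word are given by
  the library relation \<^const>\<open>sublist\<close> (contiguous sublists).\<close>

definition cube :: "'a list \<Rightarrow> bool" where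
  "cube w \<longleftrightarrow> (\<exists>x. x \<noteq> [] \<and> w = x @ x @ x)"

definition cubefree :: "'a list \<Rightarrow> bool" where
  "cubefree w \<longleftrightarrow> (\<forall>u. sublist u w \<longrightarrow> \<not> cube u)"

definition flip_letter :: "nat \<Rightarrow> bool list \<Rightarrow> bool list" where
  "flip_letter i w = w[i := \<not> w ! i]"

definition delicate_cubefree :: "bool list \<Rightarrow> bool" where
  "delicate_cubefree w \<longleftrightarrow>
     w \<noteq> [] \<and> cubefree w \<and>
     (\<forall>i < length w. \<exists>u. sublist u (flip_letter i w) \<and> cube u)"

end

theory Submission
  imports Defs
begin

text \<open>A concatenation of delicate cubefree words is delicate as soon as it is cubefree. The word
  \<open>0110101100101100101001\<close> of length 22 and its complement are delicate, and the morphism that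
  sends the two letters to them has a cubefree fixed point: a cube of small period would lie in
  four consecutive images, and a cube of period at least 22 desubstitutes to a cube of a smaller
  period, because the images only occur aligned. Segments of this fixed point are appended to one
  of 22 delicate words whose lengths represent all residues modulo 22; all these words end in
  \<open>11001\<close>, which the fixed point continues to \<open>11001100\<close>, a word that is not a factor of
  the fixed point, so that no long cube reaches across the border. For the lengths below 38, a
  backtracking search extends words to the left and gives up when a letter can no longer be part
  of a near cube.\<close>

subsection \<open>Detecting cubes by evaluation\<close>

text \<open>A segment of length \<open>3 * p\<close> with period \<open>p\<close> is a cube; in this
  form the repeated word need not be named.\<close>

definition cube_at :: "bool list \<Rightarrow> nat \<Rightarrow> nat \<Rightarrow> bool" where
  "cube_at w s p \<longleftrightarrow> 0 < p \<and> s + 3 * p \<le> length w \<and> (\<forall>k < 2 * p. w ! (s + k) = w ! (s + k + p))"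

lemma sublist_cube_iff: "(\<exists>u. sublist u w \<and> cube u) \<longleftrightarrow> (\<exists>s p. cube_at w s p)"
proof
  assume "\<exists>u. sublist u w \<and> cube u"
  then obtain a b x where x: "x \<noteq> []" and w: "w = a @ (x @ x @ x) @ b"
    unfolding sublist_def cube_def by blast
  have "w ! (length a + k) = w ! (length a + k + length x)" if "k < 2 * length x" for k
    using that unfolding w by (cases "k < length x") (auto simp: nth_append)
  then have "cube_at w (length a) (length x)"
    using x unfolding cube_at_def by (auto simp: w)
  then show "\<exists>s p. cube_at w s p" by blast
next
  assume "\<exists>s p. cube_at w s p"
  then obtain s p where p: "0 < p" and len: "s + 3 * p \<le> length w"
    and eq: "\<And>k. k < 2 * p \<Longrightarrow> w ! (s + k) = w ! (s + k + p)"
    unfolding cube_at_def by blast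
  define x where "x = take p (drop s w)"
  have lx: "length x = p" using len by (simp add: x_def)
  have "take (3 * p) (drop s w) = x @ x @ x"
  proof (rule nth_equalityI)
    show "length (take (3 * p) (drop s w)) = length (x @ x @ x)" using len lx by simp
  next
    fix i assume "i < length (take (3 * p) (drop s w))"
    then have i: "i < 3 * p" using len by simp
    have x_nth: "x ! j = w ! (s + j)" if "j < p" for j using that len by (simp add: x_def)
    consider "i < p" | "p \<le> i" "i < 2 * p" | "2 * p \<le> i" by linarith
    then have "(x @ x @ x) ! i = w ! (s + i)"
    proof cases
      case 1
      then show ?thesis by (simp add: nth_append lx x_nth)
    next
      case 2
      then have "i - p < p" "w ! (s + (i - p)) = w ! (s + i)" using eq[of "i - p"] by simp_all
      then show ?thesis using 2 by (simp add: nth_append lx x_nth)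
    next
      case 3
      then have "w ! (s + (i - 2 * p)) = w ! (s + (i - p))"
        using i eq[of "i - 2 * p"] by (simp add: algebra_simps)
      also have "\<dots> = w ! (s + i)" using 3 i p eq[of "i - p"] by simp
      finally have "x ! (i - p - p) = w ! (s + i)" using 3 i by (simp add: x_nth mult_2)
      moreover have "\<not> i < p" "\<not> i - p < p" using 3 p by linarith+
      ultimately show ?thesis by (simp add: nth_append lx)
    qed
    then show "take (3 * p) (drop s w) ! i = (x @ x @ x) ! i" using i len by simp
  qed
  moreover have "sublist (take (3 * p) (drop s w)) w"
    by (meson sublist_drop sublist_order.order.trans sublist_take)
  moreover have "x \<noteq> []" using lx p by auto
  ultimately show "\<exists>u. sublist u w \<and> cube u" unfolding cube_def by metis
qed

lemma cubefree_iff: "cubefree w \<longleftrightarrow> (\<forall>s p. \<not> cube_at w s p)"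
  using sublist_cube_iff[of w] unfolding cubefree_def by blast

lemma delicate_cubefree_iff:
  "delicate_cubefree w \<longleftrightarrow>
     w \<noteq> [] \<and> cubefree w \<and> (\<forall>i < length w. \<not> cubefree (flip_letter i w))"
  unfolding delicate_cubefree_def cubefree_def by blast

lemma cubefree_sublist: "cubefree w \<Longrightarrow> sublist u w \<Longrightarrow> cubefree u"
  unfolding cubefree_def by (meson sublist_order.order.trans)

text \<open>Matching on the letters lets evaluation stop at the first mismatch; a list that is too
  short counts as a mismatch.\<close>

fun agree :: "nat \<Rightarrow> bool list \<Rightarrow> bool list \<Rightarrow> bool" where
  "agree 0 xs ys \<longleftrightarrow> True"
| "agree (Suc k) (False # xs) (False # ys) \<longleftrightarrow> agree k xs ys"
| "agree (Suc k) (True # xs) (True # ys) \<longleftrightarrow> agree k xs ys"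
| "agree (Suc k) _ _ \<longleftrightarrow> False"

lemma agree_iff:
  "agree k xs ys \<longleftrightarrow> k \<le> length xs \<and> k \<le> length ys \<and> (\<forall>i < k. xs ! i = ys ! i)"
proof (induction k xs ys rule: agree.induct)
  case 1
  then show ?case by simp
qed (auto simp: less_Suc_eq_0_disj)

text \<open>Tries the periods one after the other: in the round for period \<open>p\<close>, the second argument
  is \<open>w\<close> without \<open>p - 1\<close> letters, the third is \<open>w\<close> without \<open>3 (p - 1)\<close> letters, so that it
  still has three letters iff a cube of period \<open>p\<close> fits into \<open>w\<close>, and the last is \<open>2 p\<close>.\<close>

fun cube_scan :: "bool list \<Rightarrow> bool list \<Rightarrow> bool list \<Rightarrow> nat \<Rightarrow> bool" where
  "cube_scan w (y # ys) (_ # _ # _ # zs) k \<longleftrightarrow> agree k w ys \<or> cube_scan w ys zs (Suc (Suc k))"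
| "cube_scan w _ _ k \<longleftrightarrow> False"

definition starts_cube :: "bool list \<Rightarrow> bool" where
  "starts_cube w = cube_scan w w w (Suc (Suc 0))"

fun has_cube :: "bool list \<Rightarrow> bool" where
  "has_cube [] = False"
| "has_cube (c # w) = (starts_cube (c # w) \<or> has_cube w)"

text \<open>The state of the scan after \<open>q\<close> rounds: only the periods above
  \<open>q\<close> remain to be tried.\<close>

lemma cube_scan_iff:
  "cube_scan w (drop q w) (drop (3 * q) w) (Suc (Suc (2 * q))) \<longleftrightarrow> (\<exists>p > q. cube_at w 0 p)"
proof (induction "length w - q" arbitrary: q rule: less_induct)
  case less
  show ?case
  proof (cases "3 * Suc q \<le> length w")
    case False
    have "\<not> cube_scan w (drop q w) (drop (3 * q) w) (Suc (Suc (2 * q)))"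
    proof
      assume "cube_scan w (drop q w) (drop (3 * q) w) (Suc (Suc (2 * q)))"
      then obtain a b c zs where "drop (3 * q) w = a # b # c # zs"
        by (cases "(w, drop q w, drop (3 * q) w, Suc (Suc (2 * q)))" rule: cube_scan.cases) auto
      then have "length w - 3 * q \<ge> 3" by (metis length_Cons length_drop le_add2 numeral_3_eq_3 Suc_le_mono zero_le)
      then show False using False by simp
    qed
    moreover have "\<not> cube_at w 0 p" if "p > q" for p
      using False that by (simp add: cube_at_def)
    ultimately show ?thesis by blast
  next
    case True
    have 1: "drop q w = w ! q # drop (Suc q) w"
      using True by (simp add: Cons_nth_drop_Suc)
    have "drop (3 * q) w = w ! (3 * q) # w ! Suc (3 * q) # w ! Suc (Suc (3 * q)) #
        drop (Suc (Suc (Suc (3 * q)))) w"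
      using True by (simp add: Cons_nth_drop_Suc)
    then have 2: "drop (3 * q) w = w ! (3 * q) # w ! Suc (3 * q) # w ! Suc (Suc (3 * q)) #
        drop (3 * Suc q) w"
      by (simp add: numeral_3_eq_3)
    have 3: "agree (2 * Suc q) w (drop (Suc q) w) \<longleftrightarrow> cube_at w 0 (Suc q)"
      using True by (auto simp: agree_iff cube_at_def add.commute)
    have "cube_scan w (drop q w) (drop (3 * q) w) (Suc (Suc (2 * q))) \<longleftrightarrow>
      agree (2 * Suc q) w (drop (Suc q) w) \<or>
      cube_scan w (drop (Suc q) w) (drop (3 * Suc q) w) (Suc (Suc (2 * Suc q)))"
      unfolding 1 2 by simp
    also have "\<dots> \<longleftrightarrow> cube_at w 0 (Suc q) \<or> (\<exists>p > Suc q. cube_at w 0 p)"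
      using less[of "Suc q"] True 3 by simp
    also have "\<dots> \<longleftrightarrow> (\<exists>p > q. cube_at w 0 p)"
      by (metis Suc_lessI lessI Suc_lessD)
    finally show ?thesis .
  qed
qed

lemma starts_cube_iff: "starts_cube w \<longleftrightarrow> (\<exists>p. cube_at w 0 p)"
  using cube_scan_iff[of w 0] by (auto simp: starts_cube_def cube_at_def)

lemma cube_at_Cons_Suc [simp]: "cube_at (c # w) (Suc s) p \<longleftrightarrow> cube_at w s p"
  by (simp add: cube_at_def)

lemma cubefree_Nil: "cubefree ([] :: bool list)"
  by (auto simp: cubefree_iff cube_at_def)

lemma cubefree_Cons: "cubefree (c # w) \<longleftrightarrow> \<not> starts_cube (c # w) \<and> cubefree w"
  unfolding cubefree_iff starts_cube_iff by (metis cube_at_Cons_Suc not0_implies_Suc)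

lemma has_cube_iff: "has_cube w \<longleftrightarrow> \<not> cubefree w"
  by (induction w) (auto simp: cubefree_Nil cubefree_Cons)

section \<open>Letter changes that keep a word cubefree\<close>

text \<open>Words are built from right to left. For a cubefree word, we keep the list of the words that
  are obtained by changing one letter and are still cubefree, each with the position of the
  change. After a new letter is put in front, only cubes that start at that letter can be new.\<close>

definition advance :: "bool \<Rightarrow> bool list \<Rightarrow> (nat \<times> bool list) list \<Rightarrow> (nat \<times> bool list) list" where
  "advance c u ps = filter (\<lambda>(i, v). \<not> starts_cube v)
     ((0, (\<not> c) # u) # map (\<lambda>(i, v). (Suc i, c # v)) ps)"

fun unsettled :: "bool list \<Rightarrow> (nat \<times> bool list) list" where
  "unsettled [] = []"
| "unsettled (c # u) = advance c u (unsettled u)"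

lemma flip_letter_Cons [simp]:
  "flip_letter 0 (c # u) = (\<not> c) # u"
  "flip_letter (Suc i) (c # u) = c # flip_letter i u"
  by (simp_all add: flip_letter_def)

lemma length_flip_letter [simp]: "length (flip_letter i u) = length u"
  by (simp add: flip_letter_def)

lemma flip_letter_append:
  "flip_letter i (u @ v) =
    (if i < length u then flip_letter i u @ v else u @ flip_letter (i - length u) v)"
  by (simp add: flip_letter_def list_update_append nth_append)

lemma mem_unsettled_iff:
  "cubefree w \<Longrightarrow>
    x \<in> set (unsettled w) \<longleftrightarrow> (\<exists>i < length w. x = (i, flip_letter i w) \<and> cubefree (flip_letter i w))"
proof (induction w arbitrary: x)
  case Nil
  then show ?case by simp
next
  case (Cons c w)
  then have cf: "cubefree w" by (simp add: cubefree_Cons)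
  then have IH: "x \<in> set (unsettled w) \<longleftrightarrow>
      (\<exists>i < length w. x = (i, flip_letter i w) \<and> cubefree (flip_letter i w))" for x
    by (rule Cons.IH)
  have "x \<in> set (unsettled (c # w)) \<longleftrightarrow>
      x = (0, (\<not> c) # w) \<and> \<not> starts_cube ((\<not> c) # w) \<or>
      (\<exists>i v. (i, v) \<in> set (unsettled w) \<and> x = (Suc i, c # v) \<and> \<not> starts_cube (c # v))"
    by (auto simp: advance_def)
  also have "\<dots> \<longleftrightarrow> (\<exists>i < length (c # w). x = (i, flip_letter i (c # w)) \<and>
      cubefree (flip_letter i (c # w)))"
    using cf by (auto simp: IH Ex_less_Suc2 cubefree_Cons)
  finally show ?case .
qed

lemma unsettled_eq_Nil_iff:
  assumes "cubefree w"
  shows "unsettled w = [] \<longleftrightarrow> (\<forall>i < length w. \<not> cubefree (flip_letter i w))"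
proof -
  have "unsettled w = [] \<longleftrightarrow> (\<forall>x. x \<notin> set (unsettled w))" by auto
  then show ?thesis by (simp add: mem_unsettled_iff[OF assms])
qed

lemma delicate_cubefree_check:
  "delicate_cubefree w \<longleftrightarrow> w \<noteq> [] \<and> \<not> has_cube w \<and> unsettled w = []"
  unfolding delicate_cubefree_iff has_cube_iff using unsettled_eq_Nil_iff by blast

text \<open>A cube created by a change inside one factor survives in the concatenation.\<close>

lemma delicate_cubefree_append:
  assumes "delicate_cubefree u" "delicate_cubefree v" "cubefree (u @ v)"
  shows "delicate_cubefree (u @ v)"
  unfolding delicate_cubefree_iff
proof (intro conjI allI impI)
  show "u @ v \<noteq> []" "cubefree (u @ v)" using assms by (auto simp: delicate_cubefree_iff)
  fix i assume i: "i < length (u @ v)"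
  show "\<not> cubefree (flip_letter i (u @ v))"
  proof (cases "i < length u")
    case True
    then have "\<not> cubefree (flip_letter i u)" using assms(1) by (simp add: delicate_cubefree_iff)
    then show ?thesis using True cubefree_sublist by (auto simp: flip_letter_append)
  next
    case False
    then have "\<not> cubefree (flip_letter (i - length u) v)"
      using assms(2) i by (simp add: delicate_cubefree_iff)
    then show ?thesis using False cubefree_sublist by (auto simp: flip_letter_append)
  qed
qed

subsection \<open>Exhaustive search for short words\<close>

text \<open>Let \<open>v\<close> be cubefree and arise from \<open>u\<close> by changing the letter at position \<open>i\<close>. Suppose that
  at most \<open>n\<close> letters can still be put in front. A cube of period \<open>p\<close> that then covers position
  \<open>i\<close> ends behind position \<open>i\<close> and covers at least \<open>3 p - n\<close> letters of \<open>v\<close>. So \<open>v\<close> must agree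
  with itself shifted by \<open>p\<close> on the first \<open>i + 1 - p\<close> and \<open>2 p - n\<close> letters. In the round for
  period \<open>p\<close>, the last three arguments are \<open>i + 1 - p\<close>, \<open>n - 2 p\<close> and \<open>2 p - n\<close>.\<close>

fun fixable :: "bool list \<Rightarrow> bool list \<Rightarrow> nat \<Rightarrow> nat \<Rightarrow> nat \<Rightarrow> bool" where
  "fixable v [] k r l \<longleftrightarrow> False"
| "fixable v (y # ys) k r l \<longleftrightarrow> agree k v ys \<and> agree l v ys \<or>
     fixable v ys (k - Suc 0) (r - Suc (Suc 0)) ((Suc (Suc 0) - r) + l)"

fun hopeless :: "nat \<Rightarrow> (nat \<times> bool list) list \<Rightarrow> bool" where
  "hopeless n [] \<longleftrightarrow> False"
| "hopeless n ((i, v) # ps) \<longleftrightarrow>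
     \<not> fixable v v i (n - Suc (Suc 0)) (Suc (Suc 0) - n) \<or> hopeless n ps"

lemma fixableI_aux:
  assumes "q < p" "p \<le> length v"
    and "agree (Suc i - p) v (drop p v)" "agree (2 * p - n) v (drop p v)"
  shows "fixable v (drop q v) (i - q) (n - Suc (Suc (2 * q))) (Suc (Suc (2 * q)) - n)"
  using assms(1)
proof (induction "p - q" arbitrary: q rule: less_induct)
  case less
  have 1: "drop q v = v ! q # drop (Suc q) v"
    using less.prems assms(2) by (simp add: Cons_nth_drop_Suc)
  show ?case
  proof (cases "p = Suc q")
    case True
    then show ?thesis using assms(3,4) by (simp add: 1)
  next
    case False
    \<comment> \<open>Of the truncated differences \<open>n - 2 p\<close> and \<open>2 p - n\<close>
      at most one is positive: what can no longer be subtracted from the first is added to the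
      second.\<close>
    have "(Suc (Suc 0) - (n - Suc (Suc (2 * q)))) + (Suc (Suc (2 * q)) - n) =
        Suc (Suc (2 * Suc q)) - n" by arith
    moreover have "n - Suc (Suc (2 * q)) - Suc (Suc 0) = n - Suc (Suc (2 * Suc q))" by simp
    moreover have "i - q - Suc 0 = i - Suc q" by simp
    moreover have "fixable v (drop (Suc q) v) (i - Suc q) (n - Suc (Suc (2 * Suc q)))
        (Suc (Suc (2 * Suc q)) - n)"
      using less.hyps[of "Suc q"] less.prems False by simp
    ultimately show ?thesis unfolding 1 fixable.simps by metis
  qed
qed

text \<open>The new cube starts in \<open>t\<close>, because \<open>flip_letter i u\<close> is
  cubefree, and it covers the changed letter, because \<open>t @ u\<close> is cubefree. Its part
  behind \<open>t\<close> inherits the period.\<close>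

lemma fixable_if_cube:
  assumes i: "i < length u" and t: "length t \<le> n"
    and cf: "cubefree (t @ u)" "cubefree (flip_letter i u)"
    and cube: "\<not> cubefree (t @ flip_letter i u)"
  shows "fixable (flip_letter i u) (flip_letter i u) i (n - Suc (Suc 0)) (Suc (Suc 0) - n)"
proof -
  define v where "v = flip_letter i u"
  have lv: "length v = length u" by (simp add: v_def)
  obtain s p where sp: "cube_at (t @ v) s p"
    using cube unfolding cubefree_iff v_def by blast
  then have p: "0 < p" and e_le: "s + 3 * p \<le> length t + length v"
    and eq: "\<And>k. k < 2 * p \<Longrightarrow> (t @ v) ! (s + k) = (t @ v) ! (s + k + p)"
    by (auto simp: cube_at_def)
  have s: "s < length t"
  proof (rule ccontr)
    assume "\<not> s < length t"
    then have "cube_at v (s - length t) p"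
      using sp by (auto simp: cube_at_def nth_append)
    then show False using cf(2) by (auto simp: cubefree_iff v_def)
  qed
  have e: "s + 3 * p > length t + i"
  proof (rule ccontr)
    assume *: "\<not> s + 3 * p > length t + i"
    have nth: "(t @ v) ! j = (t @ u) ! j" if "j < length t + i" for j
      using that by (auto simp: v_def flip_letter_def nth_append)
    have "cube_at (t @ u) s p"
      using sp * unfolding cube_at_def by (auto simp: lv nth)
    then show False using cf(1) by (auto simp: cubefree_iff)
  qed
  have per: "v ! k = v ! (p + k)" if "length t + k + p < s + 3 * p" for k
    using eq[of "length t + k - s"] that s by (simp add: nth_append add.commute add.left_commute)
  have "\<exists>p. 0 < p \<and> p \<le> length v \<and>
      agree (Suc i - p) v (drop p v) \<and> agree (2 * p - n) v (drop p v)"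
  proof (cases "p \<le> length v")
    case True
    have "agree (Suc i - p) v (drop p v)"
      unfolding agree_iff using True i e e_le lv per by auto
    moreover have "agree (2 * p - n) v (drop p v)"
      unfolding agree_iff using True e_le t lv per by auto
    ultimately show ?thesis using p True by blast
  next
    \<comment> \<open>So long a period forces \<open>2 * length v \<le> n\<close>; then the period
      \<open>length v\<close> passes with both agreement lengths 0.\<close>
    case False
    then have "2 * length v \<le> n" using e_le e t by linarith
    then show ?thesis using i lv by (intro exI[of _ "length v"]) auto
  qed
  then show ?thesis using fixableI_aux[of 0 _ v i n] by (auto simp: v_def)
qed

lemma not_hopeless:
  assumes "\<And>i v. (i, v) \<in> set ps \<Longrightarrow> fixable v v i (n - Suc (Suc 0)) (Suc (Suc 0) - n)"
  shows "\<not> hopeless n ps"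
  using assms by (induction ps) auto

text \<open>Here \<open>n\<close> bounds the letters still to be put in front, \<open>ls\<close>
  lists the permitted lengths, and \<open>ps\<close> stands for \<open>unsettled u\<close>, carried
  along to be updated instead of recomputed.\<close>

fun search :: "nat list \<Rightarrow> nat \<Rightarrow> bool list \<Rightarrow> (nat \<times> bool list) list \<Rightarrow> bool" where
  "search ls 0 u ps \<longleftrightarrow>
     starts_cube u \<or> hopeless 0 ps \<or> u = [] \<or> ps \<noteq> [] \<or> length u \<in> set ls"
| "search ls (Suc n) u ps \<longleftrightarrow>
     starts_cube u \<or> hopeless (Suc n) ps \<or>
     (u = [] \<or> ps \<noteq> [] \<or> length u \<in> set ls) \<and>
     search ls n (False # u) (advance False u ps) \<and> search ls n (True # u) (advance True u ps)"

text \<open>Neither pruning rule discards a suffix of a delicate word: it is cubefree, and every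
  change still unsettled must produce a cube with the letters in front.\<close>

lemma search_sound:
  assumes "search ls n u (unsettled u)" "length t \<le> n" "delicate_cubefree (t @ u)"
  shows "length (t @ u) \<in> set ls"
  using assms
proof (induction n arbitrary: u t)
  have pruning: "\<not> starts_cube u \<and> \<not> hopeless n (unsettled u)"
    if d: "delicate_cubefree (t @ u)" and t: "length t \<le> n" for n u t
  proof
    have cf: "cubefree (t @ u)" using d by (simp add: delicate_cubefree_iff)
    then have u: "cubefree u" by (rule cubefree_sublist) simp
    then show "\<not> starts_cube u" by (auto simp: starts_cube_iff cubefree_iff)
    show "\<not> hopeless n (unsettled u)"
    proof (rule not_hopeless)
      fix i v assume "(i, v) \<in> set (unsettled u)"
      then have i: "i < length u" and v: "v = flip_letter i u" "cubefree (flip_letter i u)"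
        by (auto simp: mem_unsettled_iff[OF u])
      have "\<not> cubefree (flip_letter (length t + i) (t @ u))"
        using d i by (simp add: delicate_cubefree_iff)
      then have "\<not> cubefree (t @ flip_letter i u)"
        by (simp add: flip_letter_append)
      then show "fixable v v i (n - Suc (Suc 0)) (Suc (Suc 0) - n)"
        using fixable_if_cube[OF i t cf] v by simp
    qed
  qed
  have hit: "length u \<in> set ls"
    if "delicate_cubefree u" "u = [] \<or> unsettled u \<noteq> [] \<or> length u \<in> set ls" for u
    using that by (auto simp: delicate_cubefree_check)
  {
    case 0
    then show ?case using pruning[of t u 0] hit[of u] by auto
  next
    case (Suc n)
    have s: "(u = [] \<or> unsettled u \<noteq> [] \<or> length u \<in> set ls) \<and>
       search ls n (False # u) (unsettled (False # u)) \<and> search ls n (True # u) (unsettled (True # u))"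
      using Suc.prems pruning[of t u "Suc n"] by auto
    show ?case
    proof (cases t rule: rev_cases)
      case Nil
      then show ?thesis using Suc.prems s hit[of u] by simp
    next
      \<comment> \<open>Words grow to the left, so the next letter is the last one of
        \<open>t\<close>.\<close>
      case (snoc t' c)
      have "search ls n (c # u) (unsettled (c # u))" using s by (cases c) simp_all
      then show ?thesis using Suc.IH[of "c # u" t'] Suc.prems snoc by simp
    qed
  }
qed

lemma search_37: "search [20, 21, 22, 29, 33, 34, 35] 37 [] []"
  by code_simp

lemma short_delicate_cubefree:
  assumes "delicate_cubefree w" "length w < 38"
  shows "length w \<in> {20, 21, 22, 29, 33, 34, 35}"
proof -
  have "search [20, 21, 22, 29, 33, 34, 35] 37 [] (unsettled [])" using search_37 by simp
  from search_sound[OF this, of w] assms show ?thesis by simp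
qed

subsection \<open>An infinite cubefree word made of delicate blocks\<close>

definition word :: "string \<Rightarrow> bool list" where
  "word s = map (\<lambda>c. c = CHR ''1'') s"

definition seed :: "bool list" where
  "seed = word ''0110101100101100101001''"

text \<open>Exclusive or with \<open>b\<close>: \<open>block False\<close> is the seed and
  \<open>block True\<close> its complement.\<close>

definition block :: "bool \<Rightarrow> bool list" where
  "block b = map (\<lambda>c. c \<noteq> b) seed"

text \<open>The fixed point of the morphism that maps the letter \<open>b\<close> to \<open>block b\<close>.\<close>

fun fixpt :: "nat \<Rightarrow> bool" where
  "fixpt n = (if n = 0 then False else block (fixpt (n div 22)) ! (n mod 22))"

declare fixpt.simps [simp del]

lemma length_seed [simp]: "length seed = 22"
  by (simp add: seed_def word_def)

lemma length_block [simp]: "length (block b) = 22"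
  by (simp add: block_def)

lemma nth_block: "r < 22 \<Longrightarrow> block b ! r = (seed ! r \<noteq> b)"
  by (simp add: block_def)

text \<open>The value that stops the recursion at 0 is consistent because the seed begins with
  0.\<close>

lemma fixpt_eq_block: "fixpt n = block (fixpt (n div 22)) ! (n mod 22)"
proof (cases "n = 0")
  case True
  have "fixpt 0 = False" by (simp add: fixpt.simps)
  moreover have "seed ! 0 = False" by (simp add: seed_def word_def)
  ultimately show ?thesis using True by (simp add: nth_block)
next
  case False
  then show ?thesis by (subst fixpt.simps) simp
qed

lemma fixpt_block:
  assumes "r < 22"
  shows "fixpt (22 * q + r) = block (fixpt q) ! r"
  using assms by (subst fixpt_eq_block) simp

lemma fixpt_two_blocks:
  assumes "j < 44"
  shows "fixpt (22 * q + j) = (block (fixpt q) @ block (fixpt (q + 1))) ! j"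
  using assms fixpt_block[of j q] fixpt_block[of "j - 22" "q + 1"]
  by (cases "j < 22") (simp_all add: nth_append algebra_simps)

lemma fixpt_four_blocks:
  assumes "j < 88"
  shows "fixpt (22 * q + j) =
    ((block (fixpt q) @ block (fixpt (q + 1))) @ block (fixpt (q + 2)) @ block (fixpt (q + 3))) ! j"
proof (cases "j < 44")
  case True
  then show ?thesis using fixpt_two_blocks[of j q] by (subst nth_append) simp
next
  case False
  then have "22 * q + j = 22 * (q + 2) + (j - 44)" by simp
  then show ?thesis using False assms fixpt_two_blocks[of "j - 44" "q + 2"]
    by (subst nth_append) (simp add: numeral_3_eq_3)
qed

lemma delicate_cubefree_block: "delicate_cubefree (block b)"
proof -
  have "delicate_cubefree (block True)" "delicate_cubefree (block False)"
    unfolding delicate_cubefree_check by code_simp+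
  then show ?thesis by (cases b) simp_all
qed

lemma two_blocks_cubefree: "cubefree (block a @ block b)"
proof -
  have "\<not> has_cube (block False @ block False) \<and> \<not> has_cube (block False @ block True) \<and>
    \<not> has_cube (block True @ block False) \<and> \<not> has_cube (block True @ block True)"
    by code_simp
  then show ?thesis by (cases a; cases b) (simp_all add: has_cube_iff)
qed

text \<open>Three equal letters in a row are excluded, as their images form a cube; the other
  quadruples are evaluated.\<close>

lemma four_blocks_cubefree:
  assumes "\<not> (a = b \<and> b = c)" "\<not> (b = c \<and> c = d)"
  shows "cubefree ((block a @ block b) @ block c @ block d)"
proof -
  have "list_all (\<lambda>(a, b, c, d). (a = b \<and> b = c) \<or> (b = c \<and> c = d) \<or>
      \<not> has_cube ((block a @ block b) @ block c @ block d))
    [(a, b, c, d). a \<leftarrow> [False, True], b \<leftarrow> [False, True], c \<leftarrow> [False, True], d \<leftarrow> [False, True]]"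
    by code_simp
  then show ?thesis using assms by (cases a; cases b; cases c; cases d) (simp_all add: has_cube_iff)
qed

lemma block_occurrence_aligned:
  assumes "agree 22 (block a) (drop r (block b @ block c))" "r < 22"
  shows "r = 0"
proof (rule ccontr)
  assume "r \<noteq> 0"
  then have r: "r \<in> set [1..<22]" using assms(2) by simp
  have "list_all (\<lambda>(a, b, c). list_all (\<lambda>r. \<not> agree 22 (block a) (drop r (block b @ block c))) [1..<22])
    [(a, b, c). a \<leftarrow> [False, True], b \<leftarrow> [False, True], c \<leftarrow> [False, True]]"
    by code_simp
  then have "list_all (\<lambda>r. \<not> agree 22 (block a) (drop r (block b @ block c))) [1..<22]"
    by (cases a; cases b; cases c) (simp_all del: upt_rec_numeral)
  then show False using assms(1) r by (simp add: list_all_iff del: upt_rec_numeral)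
qed

lemma fixpt_cubefree:
  assumes "0 < p" "\<And>k. k < 2 * p \<Longrightarrow> fixpt (s + k) = fixpt (s + k + p)"
  shows False
  using assms
proof (induction p arbitrary: s rule: less_induct)
  case (less p)
  have no_period_1: "\<not> (fixpt s = fixpt (s + 1) \<and> fixpt (s + 1) = fixpt (s + 2))" for s
  proof
    assume *: "fixpt s = fixpt (s + 1) \<and> fixpt (s + 1) = fixpt (s + 2)"
    define q r where "q = s div 22" and "r = s mod 22"
    have s: "s = 22 * q + r" "r < 22" by (simp_all add: q_def r_def)
    have "cube_at (block (fixpt q) @ block (fixpt (q + 1))) r 1"
      using * s fixpt_two_blocks[of r q] fixpt_two_blocks[of "r + 1" q] fixpt_two_blocks[of "r + 2" q]
      by (auto simp: cube_at_def less_Suc_eq numeral_2_eq_2 add.assoc)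
    then show False using two_blocks_cubefree by (simp add: cubefree_iff)
  qed
  consider "p < 22" | "22 \<le> p" by linarith
  then show ?case
  proof cases
    case 1
    define q r where "q = s div 22" and "r = s mod 22"
    have s: "s = 22 * q + r" "r < 22" by (simp_all add: q_def r_def)
    define w where "w = (block (fixpt q) @ block (fixpt (q + 1))) @ block (fixpt (q + 2)) @ block (fixpt (q + 3))"
    have w: "w ! j = fixpt (22 * q + j)" if "j < 88" for j
      unfolding w_def by (rule fixpt_four_blocks[symmetric]) fact
    \<comment> \<open>The cube fits into four blocks, since \<open>r + 3 * p\<close> is at most
      84.\<close>
    have "cube_at w r p"
      using less.prems 1 s unfolding cube_at_def by (auto simp: w add.assoc) (simp add: w_def)
    moreover have "cubefree w"
      unfolding w_def using no_period_1[of q] no_period_1[of "q + 1"]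
      by (intro four_blocks_cubefree) (simp_all add: numeral_3_eq_3)
    ultimately show False by (simp add: cubefree_iff)
  next
    case 2
    \<comment> \<open>Block \<open>q\<close> is the first that starts at or after \<open>s\<close>.
      It lies within the first \<open>2 * p\<close> letters of the cube, so it recurs
      \<open>p\<close> positions later.\<close>
    define q where "q = (s + 21) div 22"
    define t r where "t = p div 22" and "r = p mod 22"
    have p: "p = 22 * t + r" "r < 22" by (simp_all add: t_def r_def)
    have q: "s \<le> 22 * q" "22 * q < s + 22" unfolding q_def by presburger+
    have "agree 22 (block (fixpt q)) (drop r (block (fixpt (q + t)) @ block (fixpt (q + t + 1))))"
      unfolding agree_iff
    proof (intro conjI allI impI)
      fix j :: nat assume j: "j < 22"
      have "fixpt (s + (22 * q + j - s)) = fixpt (s + (22 * q + j - s) + p)"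
        by (rule less.prems) (use j q 2 in linarith)
      then have "fixpt (22 * q + j) = fixpt (22 * (q + t) + (r + j))"
        using q p by (simp add: algebra_simps)
      then show "block (fixpt q) ! j = drop r (block (fixpt (q + t)) @ block (fixpt (q + t + 1))) ! j"
        using j p fixpt_block[of j q] fixpt_two_blocks[of "r + j" "q + t"]
        by (simp del: drop_append)
    qed (use p in simp_all)
    then have "r = 0" by (rule block_occurrence_aligned) fact
    then have p: "p = 22 * t" and t: "0 < t" using p 2 by auto
    \<comment> \<open>Sampling every 22nd letter keeps the position inside the block fixed, and
      there the letter determines which block it is.\<close>
    have "fixpt (s div 22 + k) = fixpt (s div 22 + k + t)" if "k < 2 * t" for k
    proof -
      have "fixpt (s + 22 * k) = fixpt (s + 22 * k + 22 * t)"
        using less.prems(2)[of "22 * k"] that p by simp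
      moreover have "fixpt (s + 22 * n) = (seed ! (s mod 22) \<noteq> fixpt (s div 22 + n))" for n
        by (subst fixpt_eq_block) (simp add: nth_block add.commute)
      from this[of k] this[of "k + t"]
      have "fixpt (s + 22 * k) = (seed ! (s mod 22) \<noteq> fixpt (s div 22 + k))"
        "fixpt (s + 22 * k + 22 * t) = (seed ! (s mod 22) \<noteq> fixpt (s div 22 + k + t))"
        by (simp_all add: algebra_simps)
      ultimately show ?thesis by blast
    qed
    moreover have "t < p" using p t by simp
    ultimately show False using less.IH t by blast
  qed
qed

text \<open>Eight letters fit into two consecutive blocks, so finitely many pairs and offsets remain
  to be evaluated.\<close>

lemma fixpt_avoids: "\<exists>j < 8. fixpt (n + j) \<noteq> word ''11001100'' ! j"
proof (rule ccontr)
  assume *: "\<not> (\<exists>j < 8. fixpt (n + j) \<noteq> word ''11001100'' ! j)"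
  define q r where "q = n div 22" and "r = n mod 22"
  have n: "n = 22 * q + r" "r < 22" by (simp_all add: q_def r_def)
  have "word ''11001100'' ! j = (block (fixpt q) @ block (fixpt (q + 1))) ! (r + j)" if "j < 8" for j
    using * n that fixpt_two_blocks[of "r + j" q] by (simp add: add.assoc)
  then have "agree 8 (word ''11001100'') (drop r (block (fixpt q) @ block (fixpt (q + 1))))"
    unfolding agree_iff using n by (simp add: word_def del: drop_append)
  moreover have "list_all (\<lambda>(b, c). list_all (\<lambda>r. \<not> agree 8 (word ''11001100'') (drop r (block b @ block c))) [0..<22])
    [(b, c). b \<leftarrow> [False, True], c \<leftarrow> [False, True]]"
    by code_simp
  then have "list_all (\<lambda>r. \<not> agree 8 (word ''11001100'') (drop r (block b @ block c))) [0..<22]" for b c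
    by (cases b; cases c) (simp_all del: upt_rec_numeral)
  then have "\<not> agree 8 (word ''11001100'') (drop r (block b @ block c))" for b c
    using n(2) by (simp add: list_all_iff del: upt_rec_numeral)
  ultimately show False by blast
qed

subsection \<open>Delicate words of all large lengths\<close>

lemma map_fixpt_block: "map fixpt [22 * q..<22 * q + 22] = block (fixpt q)"
  by (rule nth_equalityI) (simp_all add: fixpt_block)

text \<open>Positions 22 to 131 of the fixed point: the images of its letters 1 to 5, which are 1,
  1, 0, 1, 0.\<close>

definition stem :: "bool list" where
  "stem = block True @ block True @ block False @ block True @ block False"

lemma fixpt_less_22: "n < 22 \<Longrightarrow> fixpt n = seed ! n"
  using fixpt_block[of n 0] by (simp add: nth_block fixpt.simps[of 0])

lemma map_fixpt_stem: "map fixpt [22..<22 + 110] = stem"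
proof -
  have "[22..<22 + 110] = [22 * 1..<22 * 1 + 22] @ [22 * 2..<22 * 2 + 22] @ [22 * 3..<22 * 3 + 22] @
      [22 * 4..<22 * 4 + 22] @ [22 * 5..<22 * 5 + 22]"
    by simp
  then show ?thesis
    by (simp only: map_append map_fixpt_block) (simp add: stem_def fixpt_less_22 seed_def word_def)
qed

text \<open>The suffix \<open>1001\<close> of \<open>e\<close> is also a suffix of \<open>block (fixpt 0)\<close>, so that a cube
  that starts behind the first letter of the suffix \<open>11001\<close> lies in the fixed point. A cube of
  large period that starts earlier repeats \<open>11001100\<close> inside the fixed point.\<close>

lemma cubefree_append_fixpt:
  assumes e: "e = f @ word ''11001''" "length e \<le> 66" and check: "\<not> has_cube (e @ stem)"
  shows "cubefree (e @ map fixpt [22..<22 + n])"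
proof (rule ccontr)
  define l where "l = length e"
  have l: "5 \<le> l" "l \<le> 66" and f: "length f = l - 5" using e by (simp_all add: l_def word_def)
  define v where "v = (\<lambda>i. if i < l then e ! i else fixpt (i + 22 - l))"
  have v_nth: "(e @ map fixpt [22..<22 + m]) ! i = v i" if "i < l + m" for i m
    using that by (auto simp: v_def nth_append l_def add.commute)
  have e_end: "e ! (l - 5 + j) = word ''11001'' ! j" for j
    by (simp add: e nth_append f)
  have v_tail: "v i = fixpt (i + 22 - l)" if "l - 4 \<le> i" for i
  proof (cases "i < l")
    case True
    define j where "j = i + 5 - l"
    have i: "i = l - 5 + j" "i + 22 - l = 17 + j" and "j \<in> {1, 2, 3, 4}"
      using True that l unfolding j_def by auto
    then have "word ''11001'' ! j = fixpt (17 + j)"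
      by (auto simp: fixpt_less_22 seed_def word_def)
    then show ?thesis using e_end[of j] True i by (simp add: v_def)
  qed (simp add: v_def)
  have v_marker: "v (l - 5 + j) = word ''11001100'' ! j" if "j < 8" for j
  proof -
    have "j \<in> {0, 1, 2, 3, 4, 5, 6, 7}" using that by auto
    moreover have "fixpt (22 * 1 + 0) = True" "fixpt (22 * 1 + 1) = False" "fixpt (22 * 1 + 2) = False"
      by (subst fixpt_block; simp add: fixpt_less_22 nth_block seed_def word_def)+
    ultimately show ?thesis using e_end[of j] l by (auto simp: v_def word_def)
  qed
  assume "\<not> cubefree (e @ map fixpt [22..<22 + n])"
  then obtain s p where p: "0 < p" and len: "s + 3 * p \<le> l + n"
    and eq: "\<And>k. k < 2 * p \<Longrightarrow> v (s + k) = v (s + k + p)"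
    unfolding cubefree_iff cube_at_def by (auto simp: v_nth l_def)
  consider "l - 4 \<le> s" | "s < l - 4" "l + 3 \<le> 2 * p" | "s < l - 4" "2 * p < l + 3" by linarith
  then show False
  proof cases
    case 1
    have "fixpt (s + 22 - l + k) = fixpt (s + 22 - l + k + p)" if "k < 2 * p" for k
      using eq[OF that] 1 l v_tail[of "s + k"] v_tail[of "s + k + p"] by (simp add: algebra_simps)
    then show False using fixpt_cubefree p by blast
  next
    case 2
    \<comment> \<open>The marker \<open>11001100\<close> at \<open>l - 5\<close> lies in the first
      \<open>2 * p\<close> letters of the cube; its copy at \<open>l - 5 + p\<close> has index
      \<open>p + 17\<close> in the fixed point.\<close>
    have "fixpt (p + 17 + j) = word ''11001100'' ! j" if j: "j < 8" for j
    proof -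
      have "v (s + (l - 5 + j - s)) = v (s + (l - 5 + j - s) + p)"
        by (rule eq) (use 2 j in linarith)
      then have "v (l - 5 + j) = v (l - 5 + j + p)" using 2 by simp
      then show ?thesis using v_marker[OF j] v_tail[of "l - 5 + j + p"] p l
        by (simp add: algebra_simps)
    qed
    then show False using fixpt_avoids by blast
  next
    case 3
    \<comment> \<open>From \<open>p \<le> 34\<close> and \<open>s \<le> l - 5\<close> the cube ends
      at most 97 letters behind \<open>e\<close>, hence within the five blocks of
      \<open>stem\<close>.\<close>
    then have "s + 3 * p \<le> l + 110" using l by linarith
    moreover have "cube_at (e @ map fixpt [22..<22 + m]) s p" if "s + 3 * p \<le> l + m" for m
      unfolding cube_at_def using p that by (auto simp: v_nth eq l_def)
    ultimately have "cube_at (e @ stem) s p"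
      unfolding map_fixpt_stem[symmetric] by blast
    then show False using check by (auto simp: has_cube_iff cubefree_iff)
  qed
qed

section \<open>Initial words and the lengths they reach\<close>

definition starters :: "bool list list" where
  "starters = map word [
   ''01100100110011011001100100110011011001'',
   ''00101001101001101011001100100110011011001'',
   ''100101001101001101011001100100110011011001'',
   ''110101100101100101001011001100100110011011001'',
   ''0110101100101100101001011001100100110011011001'',
   ''00101001101001101011001011001100100110011011001'',
   ''001010011010011010110011011001100100110011011001'',
   ''0010100110100110101101001011001100100110011011001'',
   ''00101001101001101011010011011001100100110011011001'',
   ''001010011010011010110011001011001100100110011011001'',
   ''0010100110100110101101011001011001100100110011011001'',
   ''00101001101001101011001010011011001100100110011011001'',
   ''001010011010011010110010110011011001100100110011011001'',
   ''0010100110100110101100100110011011001100100110011011001'',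
   ''00101001101001101011010010110011011001100100110011011001'',
   ''001010011010011010110010110011001011001100100110011011001'',
   ''0010100110100110101100101001010011011001100100110011011001'',
   ''00101001101001101011001010011010011011001100100110011011001'',
   ''0010100110100110101100100110011011001011001100100110011011001'',
   ''00101001101001101011001010011010011001011001100100110011011001'',
   ''00101001101001101011001001100110110011001011001100100110011011001'',
   ''011001001100110110011001001100110110010011011001100100110011011001'']"

text \<open>Besides the lengths below 38, these cover 39, 40, 43 and 44, in whose residue classes
  the starters have lengths 61, 62, 65 and 66.\<close>

definition sporadic :: "bool list list" where
  "sporadic = map word [
   ''00101001101001101011'',
   ''001010011010011010110'',
   ''0110101100101100101001'',
   ''01100100110011011001100100110'',
   ''001010011010011010110010110010100'',
   ''0010100110100110101100101100101001'',
   ''01101011001011001010011010011010110'',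
   ''001010011010011010110101100101100101001'',
   ''0010100110100110101100101001101001101011'',
   ''0010100110100110101100110101100101100101001'',
   ''00101001101001101011001011010110010110010100'']"

lemma delicate_cubefree_sporadic: "w \<in> set sporadic \<Longrightarrow> delicate_cubefree w"
proof -
  have "list_all (\<lambda>w. w \<noteq> [] \<and> \<not> has_cube w \<and> unsettled w = []) sporadic"
    by code_simp
  then show "w \<in> set sporadic \<Longrightarrow> delicate_cubefree w"
    by (simp add: list_all_iff delicate_cubefree_check)
qed

lemma delicate_cubefree_starters: "e \<in> set starters \<Longrightarrow> delicate_cubefree e"
proof -
  have "list_all (\<lambda>w. w \<noteq> [] \<and> \<not> has_cube w \<and> unsettled w = []) starters"
    by code_simp
  then show "e \<in> set starters \<Longrightarrow> delicate_cubefree e"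
    by (simp add: list_all_iff delicate_cubefree_check)
qed

lemma starters_stem: "e \<in> set starters \<Longrightarrow> \<not> has_cube (e @ stem)"
proof -
  have "list_all (\<lambda>e. \<not> has_cube (e @ stem)) starters"
    by code_simp
  then show "e \<in> set starters \<Longrightarrow> \<not> has_cube (e @ stem)"
    by (simp add: list_all_iff)
qed

lemma starters_suffix: "e \<in> set starters \<Longrightarrow> \<exists>f. e = f @ word ''11001''"
proof -
  have "list_all (\<lambda>e. drop (length e - 5) e = word ''11001'') starters"
    by code_simp
  then show "e \<in> set starters \<Longrightarrow> \<exists>f. e = f @ word ''11001''"
    unfolding list_all_iff by (metis append_take_drop_id)
qed

lemma length_starters:
  "length ` set starters = {38, 41, 42, 45, 46, 47, 48, 49, 50, 51, 52, 53, 54, 55, 56, 57, 58, 59, 61, 62, 65, 66}"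
proof -
  have "map length starters =
      [38, 41, 42, 45, 46, 47, 48, 49, 50, 51, 52, 53, 54, 55, 56, 57, 58, 59, 61, 62, 65, 66]"
    by code_simp
  then show ?thesis by (simp flip: set_map)
qed

lemma length_sporadic: "length ` set sporadic = {20, 21, 22, 29, 33, 34, 35, 39, 40, 43, 44}"
proof -
  have "map length sporadic = [20, 21, 22, 29, 33, 34, 35, 39, 40, 43, 44]"
    by code_simp
  then show ?thesis by (simp flip: set_map)
qed

lemma delicate_cubefree_append_fixpt:
  assumes "e \<in> set starters"
  shows "delicate_cubefree (e @ map fixpt [22..<22 + 22 * m])"
proof (induction m)
  case 0
  then show ?case using delicate_cubefree_starters[OF assms] by simp
next
  case (Suc m)
  have "length e \<in> length ` set starters" using assms by (rule imageI)
  then have "length e \<le> 66" unfolding length_starters by auto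
  then have "cubefree (e @ map fixpt [22..<22 + 22 * Suc m])"
    using assms starters_suffix starters_stem cubefree_append_fixpt by blast
  moreover have "e @ map fixpt [22..<22 + 22 * Suc m] =
      (e @ map fixpt [22..<22 + 22 * m]) @ block (fixpt (Suc m))"
    using map_fixpt_block[of "Suc m"] upt_add_eq_append[of 22 "22 + 22 * m" 22]
    by (simp add: add.commute)
  ultimately show ?case
    using Suc delicate_cubefree_block delicate_cubefree_append by metis
qed

lemma length_decomposition:
  fixes n :: nat
  assumes "38 \<le> n" "n \<notin> {39, 40, 43, 44}"
  shows "\<exists>l \<in> length ` set starters. \<exists>m. n = l + 22 * m"
  using assms
proof (induction n rule: less_induct)
  case (less n)
  show ?case
  proof (cases "n \<in> length ` set starters")
    case True
    then show ?thesis by (intro bexI[of _ n] exI[of _ 0]) simp_all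
  next
    case False
    \<comment> \<open>Up to 59 only the excluded lengths lack a starter, and subtracting 22 yields
      an excluded length only from 61, 62, 65 and 66.\<close>
    then have n: "60 \<le> n" "n \<notin> {61, 62, 65, 66}"
      using less.prems unfolding length_starters insert_iff empty_iff by presburger+
    then have "38 \<le> n - 22" "n - 22 \<notin> {39, 40, 43, 44}" "n - 22 < n"
      by auto
    then obtain l m where "l \<in> length ` set starters" "n - 22 = l + 22 * m"
      using less.IH by blast
    then show ?thesis using n by (intro bexI[of _ l] exI[of _ "Suc m"]) simp_all
  qed
qed

theorem theorem5:
  fixes n :: nat
  shows "(\<exists>w :: bool list. length w = n \<and> delicate_cubefree w) \<longleftrightarrow>
    n \<in> {20, 21, 22, 29, 33, 34, 35} \<union> {m. m \<ge> 38}"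
proof
  assume "\<exists>w :: bool list. length w = n \<and> delicate_cubefree w"
  then show "n \<in> {20, 21, 22, 29, 33, 34, 35} \<union> {m. m \<ge> 38}"
    using short_delicate_cubefree by fastforce
next
  assume n: "n \<in> {20, 21, 22, 29, 33, 34, 35} \<union> {m. m \<ge> 38}"
  show "\<exists>w :: bool list. length w = n \<and> delicate_cubefree w"
  proof (cases "n \<in> length ` set sporadic")
    case True
    then show ?thesis using delicate_cubefree_sporadic by auto
  next
    case False
    then have "38 \<le> n" "n \<notin> {39, 40, 43, 44}" using n unfolding length_sporadic by auto
    then obtain e m where "e \<in> set starters" "n = length e + 22 * m"
      using length_decomposition by blast
    then show ?thesis using delicate_cubefree_append_fixpt[of e m]
      by (intro exI[of _ "e @ map fixpt [22..<22 + 22 * m]"]) simp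
  qed
qed

end
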